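(* Let $k$ be a field of characteristic $0$. Every countably generated Rota-Baxter algebra over $k$ of weight $0$ can be embedded (by an injective Rota-Baxter homomorphism) into a Rota-Baxter algebra over $k$ of weight $0$ generated by two elements.
   Context: A Rota-Baxter algebra of weight $0$ over $k$ is an associative $k$-algebra $A$ (not assumed to have a unit) with a $k$-linear operator $P:A\to A$ satisfying $P(x)P(y)=P(P(x)y)+P(xP(y))$ for all $x,y\in A$. A homomorphism of Rota-Baxter algebras is a $k$-algebra homomorphism $f$ with $f(P(a))=P(f(a))$ for all $a$. Generation is as a Rota-Baxter algebra, i.e. under linear combinations, products and $P$. *)

theory Defs
  imports
    "HOL-Algebra.Module"
    "HOL-Algebra.Algebraic_Closure_Type"
    "HOL-Library.Countable_Set"
begin

text \<open>
  The record inherits a field for a multiplicative unit from the library's ring record.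
  Algebras here need not be unital: no axiom, homomorphism condition or generation clause
  below mentions that field. For the same reason the library's locale for algebras, which asks
  for a commutative unital ring, is not used, and only the locale for modules is extended.
\<close>

record ('k, 'a) rb_algebra = "('k, 'a) module" +
  rb_op :: "'a \<Rightarrow> 'a"

locale rota_baxter_algebra = module K A
  for K :: "('k, 'm) ring_scheme" and A :: "('k, 'a) rb_algebra" +
  assumes mult_closed:
      "\<lbrakk>x \<in> carrier A; y \<in> carrier A\<rbrakk> \<Longrightarrow> x \<otimes>\<^bsub>A\<^esub> y \<in> carrier A"
    and mult_assoc:
      "\<lbrakk>x \<in> carrier A; y \<in> carrier A; z \<in> carrier A\<rbrakk> \<Longrightarrow>
        (x \<otimes>\<^bsub>A\<^esub> y) \<otimes>\<^bsub>A\<^esub> z = x \<otimes>\<^bsub>A\<^esub> (y \<otimes>\<^bsub>A\<^esub> z)"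
    and distrib_left:
      "\<lbrakk>x \<in> carrier A; y \<in> carrier A; z \<in> carrier A\<rbrakk> \<Longrightarrow>
        x \<otimes>\<^bsub>A\<^esub> (y \<oplus>\<^bsub>A\<^esub> z) = (x \<otimes>\<^bsub>A\<^esub> y) \<oplus>\<^bsub>A\<^esub> (x \<otimes>\<^bsub>A\<^esub> z)"
    and distrib_right:
      "\<lbrakk>x \<in> carrier A; y \<in> carrier A; z \<in> carrier A\<rbrakk> \<Longrightarrow>
        (x \<oplus>\<^bsub>A\<^esub> y) \<otimes>\<^bsub>A\<^esub> z = (x \<otimes>\<^bsub>A\<^esub> z) \<oplus>\<^bsub>A\<^esub> (y \<otimes>\<^bsub>A\<^esub> z)"
    and smult_mult_left:
      "\<lbrakk>c \<in> carrier K; x \<in> carrier A; y \<in> carrier A\<rbrakk> \<Longrightarrow>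
        (c \<odot>\<^bsub>A\<^esub> x) \<otimes>\<^bsub>A\<^esub> y = c \<odot>\<^bsub>A\<^esub> (x \<otimes>\<^bsub>A\<^esub> y)"
    and smult_mult_right:
      "\<lbrakk>c \<in> carrier K; x \<in> carrier A; y \<in> carrier A\<rbrakk> \<Longrightarrow>
        x \<otimes>\<^bsub>A\<^esub> (c \<odot>\<^bsub>A\<^esub> y) = c \<odot>\<^bsub>A\<^esub> (x \<otimes>\<^bsub>A\<^esub> y)"
    and rb_op_closed:
      "x \<in> carrier A \<Longrightarrow> rb_op A x \<in> carrier A"
    and rb_op_add:
      "\<lbrakk>x \<in> carrier A; y \<in> carrier A\<rbrakk> \<Longrightarrow>
        rb_op A (x \<oplus>\<^bsub>A\<^esub> y) = rb_op A x \<oplus>\<^bsub>A\<^esub> rb_op A y"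
    and rb_op_smult:
      "\<lbrakk>c \<in> carrier K; x \<in> carrier A\<rbrakk> \<Longrightarrow>
        rb_op A (c \<odot>\<^bsub>A\<^esub> x) = c \<odot>\<^bsub>A\<^esub> rb_op A x"
    and rota_baxter:
      "\<lbrakk>x \<in> carrier A; y \<in> carrier A\<rbrakk> \<Longrightarrow>
        rb_op A x \<otimes>\<^bsub>A\<^esub> rb_op A y =
          rb_op A (rb_op A x \<otimes>\<^bsub>A\<^esub> y) \<oplus>\<^bsub>A\<^esub> rb_op A (x \<otimes>\<^bsub>A\<^esub> rb_op A y)"

definition rb_hom ::
  "('k, 'm) monoid_scheme \<Rightarrow> ('k, 'a) rb_algebra \<Rightarrow> ('k, 'b) rb_algebra \<Rightarrow> ('a \<Rightarrow> 'b) set"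
where
  "rb_hom K A B = {f. f \<in> carrier A \<rightarrow> carrier B
     \<and> (\<forall>x\<in>carrier A. \<forall>y\<in>carrier A. f (x \<oplus>\<^bsub>A\<^esub> y) = f x \<oplus>\<^bsub>B\<^esub> f y)
     \<and> (\<forall>c\<in>carrier K. \<forall>x\<in>carrier A. f (c \<odot>\<^bsub>A\<^esub> x) = c \<odot>\<^bsub>B\<^esub> f x)
     \<and> (\<forall>x\<in>carrier A. \<forall>y\<in>carrier A. f (x \<otimes>\<^bsub>A\<^esub> y) = f x \<otimes>\<^bsub>B\<^esub> f y)
     \<and> (\<forall>x\<in>carrier A. f (rb_op A x) = rb_op B (f x))}"

inductive_set rb_generate ::
  "('k, 'm) monoid_scheme \<Rightarrow> ('k, 'a) rb_algebra \<Rightarrow> 'a set \<Rightarrow> 'a set"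
  for K and A and S
where
  gen: "x \<in> S \<Longrightarrow> x \<in> rb_generate K A S"
| zero: "\<zero>\<^bsub>A\<^esub> \<in> rb_generate K A S"
| add: "\<lbrakk>x \<in> rb_generate K A S; y \<in> rb_generate K A S\<rbrakk> \<Longrightarrow> x \<oplus>\<^bsub>A\<^esub> y \<in> rb_generate K A S"
| smult: "\<lbrakk>c \<in> carrier K; x \<in> rb_generate K A S\<rbrakk> \<Longrightarrow> c \<odot>\<^bsub>A\<^esub> x \<in> rb_generate K A S"
| mult: "\<lbrakk>x \<in> rb_generate K A S; y \<in> rb_generate K A S\<rbrakk> \<Longrightarrow> x \<otimes>\<^bsub>A\<^esub> y \<in> rb_generate K A S"
| rb: "x \<in> rb_generate K A S \<Longrightarrow> rb_op A x \<in> rb_generate K A S"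

definition countably_generated ::
  "('k, 'm) monoid_scheme \<Rightarrow> ('k, 'a) rb_algebra \<Rightarrow> bool"
where
  "countably_generated K A \<longleftrightarrow>
     (\<exists>S. countable S \<and> S \<subseteq> carrier A \<and> rb_generate K A S = carrier A)"

definition two_generated ::
  "('k, 'm) monoid_scheme \<Rightarrow> ('k, 'a) rb_algebra \<Rightarrow> bool"
where
  "two_generated K A \<longleftrightarrow>
     (\<exists>x\<in>carrier A. \<exists>y\<in>carrier A. rb_generate K A {x, y} = carrier A)"

text \<open>
  HOL cannot quantify existentially over types, so the two-generated algebra whose existence is
  claimed is given a fixed underlying type, namely functions from the naturals to the ground
  field \<open>'k\<close>, of which its carrier is a subset. This is no restriction: an algebra generated by
  two elements is spanned by the countably many monomials in the generators (iterated products
  and applications of the operator), so it is isomorphic to one whose carrier is a space of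
  finitely supported functions from the naturals to \<open>'k\<close>.

  The ground field is a type of class \<open>field_char_0\<close>; \<open>ring_of_type_algebra\<close> views it as the
  structure over which the locale is instantiated.
\<close>

end

theory Submission
  imports Defs
begin

text \<open>
  Let \<open>e\<close> be a formal unit. Consider the operators on \<open>k e \<oplus> A\<^sup>\<nat>\<close> that map into \<open>A\<^sup>\<nat>\<close> and commute
  with right multiplication by \<open>A\<close>, where \<open>e b\<close> is the sequence \<open>(b, 0, 0, \<dots>)\<close>. They form an
  algebra; setting \<open>P T\<close> to be the corner operator with entry \<open>P ((T e)\<^sub>0)\<close> makes it a
  Rota-Baxter algebra, which contains \<open>A\<close> as the operators with only a corner entry. If \<open>x\<close> is the
  shift with \<open>x e = 0\<close>, and \<open>y\<close> maps \<open>e\<close> to a sequence \<open>\<alpha>\<close> and \<open>w\<close> to \<open>\<alpha> w\<^sub>0 + (w\<^sub>1, 0, 0, \<dots>)\<close>, then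
  \<open>y x\<^sup>n y\<close> maps \<open>e\<close> to \<open>\<alpha> \<alpha>\<^sub>n + (\<alpha>\<^sub>n\<^sub>+\<^sub>1, 0, 0, \<dots>)\<close> and so is the corner operator with entry \<open>\<alpha>\<^sub>n\<^sub>+\<^sub>1\<close>
  whenever \<open>\<alpha>\<^sub>n = 0\<close>. With zeros at the odd positions of \<open>\<alpha>\<close> and the generators of \<open>A\<close> at the
  even ones, \<open>x\<close> and \<open>y\<close> therefore generate all of \<open>A\<close>.
\<close>

section \<open>Homomorphisms and generated subalgebras\<close>

lemma rb_hom_zero:
  assumes "rota_baxter_algebra K A" "rota_baxter_algebra K B" "f \<in> rb_hom K A B"
  shows "f \<zero>\<^bsub>A\<^esub> = \<zero>\<^bsub>B\<^esub>"
proof -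
  interpret A: rota_baxter_algebra K A by fact
  interpret B: rota_baxter_algebra K B by fact
  \<comment> \<open>The conditions in \<open>rb_hom\<close> do not mention zero; compatibility with
    the scalar 0 supplies it.\<close>
  have "f (\<zero>\<^bsub>K\<^esub> \<odot>\<^bsub>A\<^esub> \<zero>\<^bsub>A\<^esub>) = \<zero>\<^bsub>K\<^esub> \<odot>\<^bsub>B\<^esub> f \<zero>\<^bsub>A\<^esub>" "f \<zero>\<^bsub>A\<^esub> \<in> carrier B"
    using assms(3) unfolding rb_hom_def by (blast intro: A.R.zero_closed A.M.zero_closed)+
  then show ?thesis by simp
qed

lemma rb_hom_generate:
  assumes A: "rota_baxter_algebra K A" and B: "rota_baxter_algebra K B" and f: "f \<in> rb_hom K A B"
    and S: "S \<subseteq> carrier A" and T: "f ` S \<subseteq> rb_generate K B T"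
  shows "f ` rb_generate K A S \<subseteq> rb_generate K B T"
proof -
  interpret A: rota_baxter_algebra K A by fact
  have f_add: "f (x \<oplus>\<^bsub>A\<^esub> y) = f x \<oplus>\<^bsub>B\<^esub> f y"
    and f_mult: "f (x \<otimes>\<^bsub>A\<^esub> y) = f x \<otimes>\<^bsub>B\<^esub> f y"
    and f_smult: "c \<in> carrier K \<Longrightarrow> f (c \<odot>\<^bsub>A\<^esub> x) = c \<odot>\<^bsub>B\<^esub> f x"
    and f_rb: "f (rb_op A x) = rb_op B (f x)"
    if "x \<in> carrier A" "y \<in> carrier A" for x y c
    using f that by (simp_all add: rb_hom_def)
  \<comment> \<open>Membership in \<open>carrier A\<close> joins the induction because the
    conditions on \<open>f\<close> hold only there.\<close>
  have "f x \<in> rb_generate K B T \<and> x \<in> carrier A" if "x \<in> rb_generate K A S" for x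
    using that
  proof induction
    case (gen x) then show ?case using S T by auto
  next
    case zero then show ?case by (simp add: rb_hom_zero[OF A B f] rb_generate.zero)
  next
    case (add x y)
    then show ?case using f_add by (auto intro: rb_generate.add)
  next
    case (smult c x)
    then show ?case using f_smult by (auto intro: rb_generate.smult)
  next
    case (mult x y)
    then show ?case using f_mult by (auto intro: rb_generate.mult A.mult_closed)
  next
    case (rb x)
    then show ?case using f_rb by (auto intro: rb_generate.rb A.rb_op_closed)
  qed
  then show ?thesis by auto
qed

lemma rb_generate_mono: "S \<subseteq> T \<Longrightarrow> rb_generate K A S \<subseteq> rb_generate K A T"
proof
  fix x assume "S \<subseteq> T" "x \<in> rb_generate K A S"
  from this(2,1) show "x \<in> rb_generate K A T" by induction (auto intro: rb_generate.intros)
qed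

text \<open>The closure rules never consult the carrier, so generating inside a subalgebra and in
  the ambient algebra is the same.\<close>

lemma rb_generate_carrier_update: "rb_generate K (A\<lparr>carrier := C\<rparr>) S = rb_generate K A S"
proof (intro equalityI subsetI)
  fix x assume "x \<in> rb_generate K (A\<lparr>carrier := C\<rparr>) S"
  then show "x \<in> rb_generate K A S"
    by induction (auto intro: rb_generate.intros)
next
  let ?B = "A\<lparr>carrier := C\<rparr>"
  fix x assume x: "x \<in> rb_generate K A S"
  note I = rb_generate.intros[where K = K and A = ?B and S = S, simplified]
  from x show "x \<in> rb_generate K ?B S"
    by induction (rule I; assumption)+
qed

lemma (in rota_baxter_algebra) generate_closed:
  assumes "S \<subseteq> carrier A" shows "rb_generate K A S \<subseteq> carrier A"
proof
  fix x assume "x \<in> rb_generate K A S"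
  then show "x \<in> carrier A"
    by induction (use assms in \<open>auto simp: mult_closed rb_op_closed\<close>)
qed

lemma (in rota_baxter_algebra) rota_baxter_generate:
  assumes "S \<subseteq> carrier A"
  shows "rota_baxter_algebra K (A\<lparr>carrier := rb_generate K A S\<rparr>)"
proof -
  let ?H = "rb_generate K A S"
  note H = generate_closed[OF assms]
  have "submodule ?H K A"
  proof (rule submoduleI)
    fix a assume a: "a \<in> ?H"
    \<comment> \<open>No clause of generation yields negatives; the scalar -1 does.\<close>
    have "(\<ominus>\<^bsub>K\<^esub> \<one>\<^bsub>K\<^esub>) \<odot>\<^bsub>A\<^esub> a \<in> ?H" using a by (intro rb_generate.smult) auto
    moreover have "(\<ominus>\<^bsub>K\<^esub> \<one>\<^bsub>K\<^esub>) \<odot>\<^bsub>A\<^esub> a = \<ominus>\<^bsub>A\<^esub> a" using a H by (auto simp: smult_l_minus)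
    ultimately show "\<ominus>\<^bsub>A\<^esub> a \<in> ?H" by simp
  qed (use H in \<open>auto intro: rb_generate.intros\<close>)
  then have "module K (A\<lparr>carrier := ?H\<rparr>)"
    by (rule submodule.submodule_is_module) (rule module_axioms)
  then show ?thesis
    by (intro rota_baxter_algebra.intro rota_baxter_algebra_axioms.intro)
      (simp_all add: H[THEN subsetD] mult_assoc distrib_left distrib_right smult_mult_left
        smult_mult_right rb_op_add rb_op_smult rota_baxter rb_generate.intros)
qed

section \<open>Transport of structure\<close>

text \<open>
  The structure can be carried along any injection of sets: no linearity is required, so embedding
  the two-generated algebra in \<open>nat \<Rightarrow> 'k\<close> is only a matter of cardinality.
\<close>

definition transport ::
    "('a \<Rightarrow> 'b) \<Rightarrow> ('k, 'a) rb_algebra \<Rightarrow> ('k, 'b) rb_algebra" where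
  "transport f A =
    (let g = the_inv_into (carrier A) f in
    \<lparr>carrier = f ` carrier A,
     monoid.mult = (\<lambda>x y. f (g x \<otimes>\<^bsub>A\<^esub> g y)),
     one = undefined,
     ring.zero = f \<zero>\<^bsub>A\<^esub>,
     add = (\<lambda>x y. f (g x \<oplus>\<^bsub>A\<^esub> g y)),
     module.smult = (\<lambda>c x. f (c \<odot>\<^bsub>A\<^esub> g x)),
     rb_op = (\<lambda>x. f (rb_op A (g x)))\<rparr>)"

context rota_baxter_algebra
begin

lemma transport_hom:
  assumes "inj_on f (carrier A)"
  shows "f \<in> rb_hom K A (transport f A)"
  using assms by (auto simp: rb_hom_def transport_def Let_def the_inv_into_f_f)

lemma rota_baxter_transport:
  assumes "inj_on f (carrier A)"
  shows "rota_baxter_algebra K (transport f A)"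
proof (intro rota_baxter_algebra.intro moduleI abelian_groupI rota_baxter_algebra_axioms.intro)
  show "cring K" by (rule R.is_cring)
next
  fix x assume "x \<in> carrier (transport f A)"
  then obtain a where "a \<in> carrier A" "x = f a" by (auto simp: transport_def Let_def)
  then show "\<exists>y\<in>carrier (transport f A). y \<oplus>\<^bsub>transport f A\<^esub> x = \<zero>\<^bsub>transport f A\<^esub>"
    using assms by (intro bexI[of _ "f (\<ominus>\<^bsub>A\<^esub> a)"])
      (auto simp: transport_def Let_def the_inv_into_f_f M.l_neg)
qed (use assms in \<open>auto simp: transport_def Let_def the_inv_into_f_f mult_closed rb_op_closed M.a_ac
    smult_l_distr smult_r_distr smult_assoc1 mult_assoc distrib_left distrib_right
    smult_mult_left smult_mult_right rb_op_add rb_op_smult rota_baxter\<close>)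

end

section \<open>Coding terms by sequences of scalars\<close>

text \<open>One constructor per clause of generation and no laws imposed: an element may have many
  terms, since evaluation has only to be onto.\<close>

datatype 'k rb_term = Gen nat | Zero | Add "'k rb_term" "'k rb_term" | Smult 'k "'k rb_term"
  | Mult "'k rb_term" "'k rb_term" | Op "'k rb_term"

text \<open>The tags are told apart because \<open>of_nat\<close> is injective in characteristic 0.\<close>

definition node :: "nat \<Rightarrow> 'k \<Rightarrow> (nat \<Rightarrow> 'k) \<Rightarrow> (nat \<Rightarrow> 'k) \<Rightarrow> nat \<Rightarrow> 'k::semiring_1" where
  "node t c f g = (\<lambda>n. if n = 0 then of_nat t else if n = 1 then c
     else if even n then f (n div 2 - 1) else g (n div 2 - 1))"

text \<open>Each constructor has its own tag. Position 1 holds the generator index or the scalar,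
  and zeros fill absent data. With the field itself as alphabet, even uncountably many scalars can
  be coded.\<close>

primrec code_term :: "'k::semiring_1 rb_term \<Rightarrow> nat \<Rightarrow> 'k" where
  "code_term (Gen i) = node 0 (of_nat i) (\<lambda>_. 0) (\<lambda>_. 0)"
| "code_term Zero = node 1 0 (\<lambda>_. 0) (\<lambda>_. 0)"
| "code_term (Add s t) = node 2 0 (code_term s) (code_term t)"
| "code_term (Smult c s) = node 3 c (code_term s) (\<lambda>_. 0)"
| "code_term (Mult s t) = node 4 0 (code_term s) (code_term t)"
| "code_term (Op s) = node 5 0 (code_term s) (\<lambda>_. 0)"

lemma node_eq_iff:
  fixes c :: "'k::semiring_char_0"
  shows "node t c f g = node t' c' f' g' \<longleftrightarrow> t = t' \<and> c = c' \<and> f = f' \<and> g = g'"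
proof
  assume eq: "node t c f g = node t' c' f' g'"
  have "t = t'" "c = c'" using fun_cong[OF eq, of 0] fun_cong[OF eq, of 1] by (simp_all add: node_def)
  \<comment> \<open>After two header positions the sequences interleave: \<open>f n\<close> sits at
    2n + 2 and \<open>g n\<close> at 2n + 3.\<close>
  moreover have "f n = f' n" "g n = g' n" for n
    using fun_cong[OF eq, of "2 * n + 2"] fun_cong[OF eq, of "2 * n + 3"] by (simp_all add: node_def)
  ultimately show "t = t' \<and> c = c' \<and> f = f' \<and> g = g'" by auto
qed simp

lemma inj_code_term: "inj (code_term :: 'k::semiring_char_0 rb_term \<Rightarrow> _)"
proof (rule injI)
  fix s t :: "'k rb_term"
  show "code_term s = code_term t \<Longrightarrow> s = t"
  proof (induction s arbitrary: t)
    case (Gen i) then show ?case by (cases t) (auto simp: node_eq_iff)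
  next
    case Zero then show ?case by (cases t) (auto simp: node_eq_iff)
  next
    case (Add a b) then show ?case by (cases t) (auto simp: node_eq_iff)
  next
    case (Smult c a) then show ?case by (cases t) (auto simp: node_eq_iff)
  next
    case (Mult a b) then show ?case by (cases t) (auto simp: node_eq_iff)
  next
    case (Op a) then show ?case by (cases t) (auto simp: node_eq_iff)
  qed
qed

primrec eval_term :: "('k, 'a) rb_algebra \<Rightarrow> (nat \<Rightarrow> 'a) \<Rightarrow> 'k rb_term \<Rightarrow> 'a" where
  "eval_term A g (Gen i) = g i"
| "eval_term A g Zero = \<zero>\<^bsub>A\<^esub>"
| "eval_term A g (Add s t) = eval_term A g s \<oplus>\<^bsub>A\<^esub> eval_term A g t"
| "eval_term A g (Smult c s) = c \<odot>\<^bsub>A\<^esub> eval_term A g s"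
| "eval_term A g (Mult s t) = eval_term A g s \<otimes>\<^bsub>A\<^esub> eval_term A g t"
| "eval_term A g (Op s) = rb_op A (eval_term A g s)"

lemma rb_generate_eval_term: "rb_generate K A (range g) \<subseteq> range (eval_term A g)"
proof
  fix x assume "x \<in> rb_generate K A (range g)"
  then show "x \<in> range (eval_term A g)"
  proof induction
    case (gen x)
    then obtain i where "x = g i" by blast
    then show ?case by (intro range_eqI[of _ _ "Gen i"]) simp
  next
    case zero
    show ?case by (intro range_eqI[of _ _ Zero]) simp
  next
    case (add x y)
    then obtain s t where "x = eval_term A g s" "y = eval_term A g t" by blast
    then show ?case by (intro range_eqI[of _ _ "Add s t"]) simp
  next
    case (smult c x)
    then obtain s where "x = eval_term A g s" by blast
    then show ?case by (intro range_eqI[of _ _ "Smult c s"]) simp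
  next
    case (mult x y)
    then obtain s t where "x = eval_term A g s" "y = eval_term A g t" by blast
    then show ?case by (intro range_eqI[of _ _ "Mult s t"]) simp
  next
    case (rb x)
    then obtain s where "x = eval_term A g s" by blast
    then show ?case by (intro range_eqI[of _ _ "Op s"]) simp
  qed
qed

text \<open>Choose for each element one term that evaluates to it; the code of that term determines
  the element.\<close>

lemma rb_generate_injection:
  fixes A :: "('k::semiring_char_0, 'a) rb_algebra"
  assumes "countable S"
  shows "\<exists>L :: 'a \<Rightarrow> nat \<Rightarrow> 'k. inj_on L (rb_generate K A S)"
proof -
  \<comment> \<open>Inserting zero makes the enumerated set nonempty.\<close>
  define g where "g = from_nat_into (insert \<zero>\<^bsub>A\<^esub> S)"
  have "range g = insert \<zero>\<^bsub>A\<^esub> S"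
    unfolding g_def using assms by (intro range_from_nat_into) auto
  then have "rb_generate K A S \<subseteq> range (eval_term A g)"
    using rb_generate_mono[of S "range g" K A] rb_generate_eval_term[of K A g] by blast
  then have "inj_on (code_term \<circ> inv_into UNIV (eval_term A g)) (rb_generate K A S)"
    by (intro comp_inj_on inj_on_inv_into inj_on_subset[OF inj_code_term]) auto
  then show ?thesis by blast
qed

section \<open>The Rota-Baxter algebra of operators\<close>

context rota_baxter_algebra
begin

lemma zero_mult: "x \<in> carrier A \<Longrightarrow> \<zero>\<^bsub>A\<^esub> \<otimes>\<^bsub>A\<^esub> x = \<zero>\<^bsub>A\<^esub>"
  by (metis M.add.l_cancel_one' M.zero_closed M.r_zero distrib_right mult_closed)

lemma mult_zero: "x \<in> carrier A \<Longrightarrow> x \<otimes>\<^bsub>A\<^esub> \<zero>\<^bsub>A\<^esub> = \<zero>\<^bsub>A\<^esub>"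
  by (metis M.add.l_cancel_one' M.zero_closed M.r_zero distrib_left mult_closed)

definition seqs :: "(nat \<Rightarrow> 'a) set" where
  "seqs = UNIV \<rightarrow> carrier A"

text \<open>This is \<open>e a\<close>: the right multiples of the formal unit \<open>e\<close> are
  sequences, though \<open>e\<close> is not.\<close>

definition single :: "'a \<Rightarrow> nat \<Rightarrow> 'a" where
  "single a = (\<lambda>n. if n = 0 then a else \<zero>\<^bsub>A\<^esub>)"

text \<open>A pair \<open>(u, F)\<close> encodes an operator \<open>T\<close> by \<open>u = T e\<close> and the restriction \<open>F\<close> of \<open>T\<close> to sequences.\<close>

definition operators :: "((nat \<Rightarrow> 'a) \<times> ((nat \<Rightarrow> 'a) \<Rightarrow> nat \<Rightarrow> 'a)) set" where
  "operators = {(u, F). u \<in> seqs \<and> F \<in> extensional seqs \<inter> (seqs \<rightarrow> seqs)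
     \<and> (\<forall>v\<in>seqs. \<forall>w\<in>seqs. F (\<lambda>n. v n \<oplus>\<^bsub>A\<^esub> w n) = (\<lambda>n. F v n \<oplus>\<^bsub>A\<^esub> F w n))
     \<and> (\<forall>c\<in>carrier K. \<forall>w\<in>seqs. F (\<lambda>n. c \<odot>\<^bsub>A\<^esub> w n) = (\<lambda>n. c \<odot>\<^bsub>A\<^esub> F w n))
     \<and> (\<forall>b\<in>carrier A. \<forall>w\<in>seqs. F (\<lambda>n. w n \<otimes>\<^bsub>A\<^esub> b) = (\<lambda>n. F w n \<otimes>\<^bsub>A\<^esub> b))
     \<and> (\<forall>b\<in>carrier A. F (single b) = (\<lambda>n. u n \<otimes>\<^bsub>A\<^esub> b))}"

definition corner :: "'a \<Rightarrow> (nat \<Rightarrow> 'a) \<times> ((nat \<Rightarrow> 'a) \<Rightarrow> nat \<Rightarrow> 'a)" where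
  "corner a = (single a, \<lambda>w\<in>seqs. single (a \<otimes>\<^bsub>A\<^esub> w 0))"

text \<open>Multiplication is composition: if \<open>T e\<close> is the sequence \<open>v\<close>,
  then \<open>S (T e)\<close> is \<open>F v\<close>. Restricting to \<open>seqs\<close> makes
  equality of pairs agree with equality of operators.\<close>

definition operator_algebra ::
    "('k, (nat \<Rightarrow> 'a) \<times> ((nat \<Rightarrow> 'a) \<Rightarrow> nat \<Rightarrow> 'a)) rb_algebra" where
  "operator_algebra =
    \<lparr>carrier = operators,
     monoid.mult = (\<lambda>(u, F) (v, G). (F v, compose seqs F G)),
     one = undefined,
     ring.zero = ((\<lambda>n. \<zero>\<^bsub>A\<^esub>), \<lambda>w\<in>seqs. \<lambda>n. \<zero>\<^bsub>A\<^esub>),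
     add = (\<lambda>(u, F) (v, G). (\<lambda>n. u n \<oplus>\<^bsub>A\<^esub> v n, \<lambda>w\<in>seqs. \<lambda>n. F w n \<oplus>\<^bsub>A\<^esub> G w n)),
     module.smult = (\<lambda>c (u, F). (\<lambda>n. c \<odot>\<^bsub>A\<^esub> u n, \<lambda>w\<in>seqs. \<lambda>n. c \<odot>\<^bsub>A\<^esub> F w n)),
     rb_op = (\<lambda>(u, F). corner (rb_op A (u 0)))\<rparr>"

lemma seqsI: "(\<And>n. w n \<in> carrier A) \<Longrightarrow> w \<in> seqs"
  and seqsD: "w \<in> seqs \<Longrightarrow> w n \<in> carrier A"
  by (auto simp: seqs_def)

lemma single_seqs: "a \<in> carrier A \<Longrightarrow> single a \<in> seqs"
  by (auto simp: seqs_def single_def)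

lemma single_0: "single a 0 = a"
  by (simp add: single_def)

lemma single_add:
  "a \<in> carrier A \<Longrightarrow> b \<in> carrier A \<Longrightarrow> single (a \<oplus>\<^bsub>A\<^esub> b) = (\<lambda>n. single a n \<oplus>\<^bsub>A\<^esub> single b n)"
  and single_smult: "c \<in> carrier K \<Longrightarrow> single (c \<odot>\<^bsub>A\<^esub> a) = (\<lambda>n. c \<odot>\<^bsub>A\<^esub> single a n)"
  by (auto simp: single_def)

lemma add_seqs: "v \<in> seqs \<Longrightarrow> w \<in> seqs \<Longrightarrow> (\<lambda>n. v n \<oplus>\<^bsub>A\<^esub> w n) \<in> seqs"
  and smult_seqs: "c \<in> carrier K \<Longrightarrow> w \<in> seqs \<Longrightarrow> (\<lambda>n. c \<odot>\<^bsub>A\<^esub> w n) \<in> seqs"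
  and mult_seqs: "b \<in> carrier A \<Longrightarrow> w \<in> seqs \<Longrightarrow> (\<lambda>n. w n \<otimes>\<^bsub>A\<^esub> b) \<in> seqs"
  by (auto simp: seqs_def mult_closed Pi_iff)

lemma operatorsI:
  assumes "u \<in> seqs" "F \<in> extensional seqs" "\<And>w. w \<in> seqs \<Longrightarrow> F w \<in> seqs"
    and "\<And>v w. v \<in> seqs \<Longrightarrow> w \<in> seqs \<Longrightarrow> F (\<lambda>n. v n \<oplus>\<^bsub>A\<^esub> w n) = (\<lambda>n. F v n \<oplus>\<^bsub>A\<^esub> F w n)"
    and "\<And>c w. c \<in> carrier K \<Longrightarrow> w \<in> seqs \<Longrightarrow> F (\<lambda>n. c \<odot>\<^bsub>A\<^esub> w n) = (\<lambda>n. c \<odot>\<^bsub>A\<^esub> F w n)"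
    and "\<And>b w. b \<in> carrier A \<Longrightarrow> w \<in> seqs \<Longrightarrow> F (\<lambda>n. w n \<otimes>\<^bsub>A\<^esub> b) = (\<lambda>n. F w n \<otimes>\<^bsub>A\<^esub> b)"
    and "\<And>b. b \<in> carrier A \<Longrightarrow> F (single b) = (\<lambda>n. u n \<otimes>\<^bsub>A\<^esub> b)"
  shows "(u, F) \<in> operators"
  using assms by (auto simp: operators_def)

lemma operatorsD:
  assumes "(u, F) \<in> operators"
  shows "u \<in> seqs" "F \<in> extensional seqs" "\<And>w. w \<in> seqs \<Longrightarrow> F w \<in> seqs"
    and "\<And>v w. v \<in> seqs \<Longrightarrow> w \<in> seqs \<Longrightarrow> F (\<lambda>n. v n \<oplus>\<^bsub>A\<^esub> w n) = (\<lambda>n. F v n \<oplus>\<^bsub>A\<^esub> F w n)"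
    and "\<And>c w. c \<in> carrier K \<Longrightarrow> w \<in> seqs \<Longrightarrow> F (\<lambda>n. c \<odot>\<^bsub>A\<^esub> w n) = (\<lambda>n. c \<odot>\<^bsub>A\<^esub> F w n)"
    and "\<And>b w. b \<in> carrier A \<Longrightarrow> w \<in> seqs \<Longrightarrow> F (\<lambda>n. w n \<otimes>\<^bsub>A\<^esub> b) = (\<lambda>n. F w n \<otimes>\<^bsub>A\<^esub> b)"
    and "\<And>b. b \<in> carrier A \<Longrightarrow> F (single b) = (\<lambda>n. u n \<otimes>\<^bsub>A\<^esub> b)"
  using assms by (auto simp: operators_def)

text \<open>At \<open>single b\<close>, \<open>G\<close> gives \<open>v\<close> times
  \<open>b\<close>, and \<open>F\<close> commutes with right multiplication, so the composite gives
  \<open>F v\<close> times \<open>b\<close>.\<close>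

lemma operators_mult:
  assumes "(u, F) \<in> operators" "(v, G) \<in> operators"
  shows "(F v, compose seqs F G) \<in> operators"
  by (intro operatorsI) (simp_all add: compose_eq operatorsD[OF assms(1)] operatorsD[OF assms(2)]
      single_seqs add_seqs smult_seqs mult_seqs)

lemma operators_add:
  assumes "(u, F) \<in> operators" "(v, G) \<in> operators"
  shows "(\<lambda>n. u n \<oplus>\<^bsub>A\<^esub> v n, \<lambda>w\<in>seqs. \<lambda>n. F w n \<oplus>\<^bsub>A\<^esub> G w n) \<in> operators"
proof -
  note F = operatorsD[OF assms(1)] and G = operatorsD[OF assms(2)]
  have [simp]: "F w n \<in> carrier A" "G w n \<in> carrier A" "u n \<in> carrier A" "v n \<in> carrier A"
    if "w \<in> seqs" for w n using F G that by (auto intro: seqsD)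
  show ?thesis
    by (intro operatorsI) (simp_all add: F G single_seqs add_seqs smult_seqs mult_seqs
      smult_r_distr distrib_right M.a_ac seqsD)
qed

lemma operators_smult:
  assumes "(u, F) \<in> operators" "c \<in> carrier K"
  shows "(\<lambda>n. c \<odot>\<^bsub>A\<^esub> u n, \<lambda>w\<in>seqs. \<lambda>n. c \<odot>\<^bsub>A\<^esub> F w n) \<in> operators"
proof -
  note F = operatorsD[OF assms(1)]
  have [simp]: "F w n \<in> carrier A" if "w \<in> seqs" for w n using F that by (auto intro: seqsD)
  show ?thesis
    by (intro operatorsI) (simp_all add: F assms single_seqs add_seqs smult_seqs mult_seqs
      smult_r_distr smult_mult_left seqsD smult_assoc1[symmetric] R.m_comm)
qed

lemma operators_zero: "((\<lambda>n. \<zero>\<^bsub>A\<^esub>), \<lambda>w\<in>seqs. \<lambda>n. \<zero>\<^bsub>A\<^esub>) \<in> operators"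
  by (intro operatorsI) (simp_all add: seqsI single_seqs add_seqs smult_seqs mult_seqs zero_mult)

lemma corner_operators: "a \<in> carrier A \<Longrightarrow> corner a \<in> operators"
  unfolding corner_def
  by (intro operatorsI)
    (auto simp: single_seqs[unfolded single_def] add_seqs smult_seqs mult_seqs seqsD mult_closed
      fun_eq_iff single_def distrib_left smult_mult_right mult_assoc zero_mult)

lemma module_operator_algebra: "module K operator_algebra"
proof (intro moduleI abelian_groupI)
  show "cring K" by (rule R.is_cring)
next
  fix x assume "x \<in> carrier operator_algebra"
  then obtain u F where x: "x = (u, F)" "(u, F) \<in> operators"
    by (cases x) (auto simp: operator_algebra_def)
  note F = operatorsD[OF x(2)]
  show "\<exists>y\<in>carrier operator_algebra. y \<oplus>\<^bsub>operator_algebra\<^esub> x = \<zero>\<^bsub>operator_algebra\<^esub>"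
    \<comment> \<open>The negative is written as the multiple by -1, so that it is already known to
      be an operator.\<close>
    using operators_smult[OF x(2), of "\<ominus>\<^bsub>K\<^esub> \<one>\<^bsub>K\<^esub>"] F
    by (intro bexI[of _ "(\<lambda>n. (\<ominus>\<^bsub>K\<^esub> \<one>\<^bsub>K\<^esub>) \<odot>\<^bsub>A\<^esub> u n, \<lambda>w\<in>seqs. \<lambda>n. (\<ominus>\<^bsub>K\<^esub> \<one>\<^bsub>K\<^esub>) \<odot>\<^bsub>A\<^esub> F w n)"])
      (auto simp: operator_algebra_def x smult_l_minus seqsD M.l_neg fun_eq_iff)
qed (auto simp: operator_algebra_def operators_add operators_smult operators_zero operatorsD seqsD
       M.a_ac smult_l_distr smult_r_distr smult_assoc1
     intro!: extensionalityI[where A = seqs])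

lemma corner_mult:
  assumes "a \<in> carrier A" "b \<in> carrier A"
  shows "corner (a \<otimes>\<^bsub>A\<^esub> b) = corner a \<otimes>\<^bsub>operator_algebra\<^esub> corner b"
  using assms unfolding corner_def operator_algebra_def
  by (auto simp: single_seqs single_0 compose_def mult_assoc seqsD mult_closed intro!: restrict_ext)

lemma corner_add:
  assumes "a \<in> carrier A" "b \<in> carrier A"
  shows "corner (a \<oplus>\<^bsub>A\<^esub> b) = corner a \<oplus>\<^bsub>operator_algebra\<^esub> corner b"
  using assms unfolding corner_def operator_algebra_def
  by (auto simp: distrib_right seqsD mult_closed single_add intro!: restrict_ext)

lemma corner_smult:
  assumes "c \<in> carrier K" "a \<in> carrier A"
  shows "corner (c \<odot>\<^bsub>A\<^esub> a) = c \<odot>\<^bsub>operator_algebra\<^esub> corner a"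
  using assms unfolding corner_def operator_algebra_def
  by (auto simp: smult_mult_left seqsD mult_closed single_smult intro!: restrict_ext)

lemma rb_op_corner: "rb_op operator_algebra (corner a) = corner (rb_op A a)"
  by (simp add: corner_def operator_algebra_def single_def)

lemma corner_hom: "corner \<in> rb_hom K A operator_algebra"
  using corner_operators
  by (auto simp: rb_hom_def corner_mult corner_add corner_smult rb_op_corner)
    (simp add: operator_algebra_def)

lemma inj_corner: "inj_on corner (carrier A)"
  by (auto simp: inj_on_def corner_def single_def fun_eq_iff)

text \<open>The new \<open>rb_op\<close> reads only the entry \<open>(T e)_0\<close>. A corner
  factor on the left or right multiplies this entry on that side by the corner's own entry, so the
  identity reduces to that of \<open>A\<close> at \<open>u 0\<close> and \<open>v 0\<close>.\<close>

lemma rota_baxter_operator_algebra: "rota_baxter_algebra K operator_algebra"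
proof (intro rota_baxter_algebra.intro module_operator_algebra rota_baxter_algebra_axioms.intro)
  fix x y assume "x \<in> carrier operator_algebra" "y \<in> carrier operator_algebra"
  then obtain u F v G where x: "x = (u, F)" "(u, F) \<in> operators"
      and y: "y = (v, G)" "(v, G) \<in> operators"
    by (cases x, cases y) (auto simp: operator_algebra_def)
  note F = operatorsD[OF x(2)] and G = operatorsD[OF y(2)]
  let ?p = "rb_op A (u 0)" and ?q = "rb_op A (v 0)"
  have p: "?p \<in> carrier A" and q: "?q \<in> carrier A" using F G by (auto intro: rb_op_closed seqsD)
  have "rb_op operator_algebra x \<otimes>\<^bsub>operator_algebra\<^esub> rb_op operator_algebra y = corner (?p \<otimes>\<^bsub>A\<^esub> ?q)"
    using corner_mult p q by (simp add: operator_algebra_def x y)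
  moreover have "rb_op operator_algebra (rb_op operator_algebra x \<otimes>\<^bsub>operator_algebra\<^esub> y)
      = corner (rb_op A (?p \<otimes>\<^bsub>A\<^esub> v 0))"
    using G by (simp add: operator_algebra_def x y corner_def single_def)
  \<comment> \<open>This is where the last clause of \<open>operators\<close> enters:
    \<open>F\<close> sends \<open>single ?q\<close> to \<open>u\<close> times
    \<open>?q\<close>.\<close>
  moreover have "rb_op operator_algebra (x \<otimes>\<^bsub>operator_algebra\<^esub> rb_op operator_algebra y)
      = corner (rb_op A (u 0 \<otimes>\<^bsub>A\<^esub> ?q))"
    using F q by (simp add: operator_algebra_def x y corner_def)
  ultimately show "rb_op operator_algebra x \<otimes>\<^bsub>operator_algebra\<^esub> rb_op operator_algebra y =
      rb_op operator_algebra (rb_op operator_algebra x \<otimes>\<^bsub>operator_algebra\<^esub> y) \<oplus>\<^bsub>operator_algebra\<^esub>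
      rb_op operator_algebra (x \<otimes>\<^bsub>operator_algebra\<^esub> rb_op operator_algebra y)"
    using F G p q by (simp add: rota_baxter corner_add rb_op_closed mult_closed seqsD)
next
  fix x y assume "x \<in> carrier operator_algebra" "y \<in> carrier operator_algebra"
  then obtain u F v G where x: "x = (u, F)" "(u, F) \<in> operators"
      and y: "y = (v, G)" "(v, G) \<in> operators"
    by (cases x, cases y) (auto simp: operator_algebra_def)
  have "rb_op operator_algebra (x \<oplus>\<^bsub>operator_algebra\<^esub> y) = corner (rb_op A (u 0 \<oplus>\<^bsub>A\<^esub> v 0))"
    by (simp add: operator_algebra_def x y)
  also have "\<dots> = corner (rb_op A (u 0)) \<oplus>\<^bsub>operator_algebra\<^esub> corner (rb_op A (v 0))"
    using operatorsD(1)[OF x(2)] operatorsD(1)[OF y(2)]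
    by (simp add: rb_op_add rb_op_closed seqsD corner_add)
  finally show "rb_op operator_algebra (x \<oplus>\<^bsub>operator_algebra\<^esub> y)
      = rb_op operator_algebra x \<oplus>\<^bsub>operator_algebra\<^esub> rb_op operator_algebra y"
    by (simp add: operator_algebra_def x y)
next
  fix c x assume c: "c \<in> carrier K" and "x \<in> carrier operator_algebra"
  then obtain u F where x: "x = (u, F)" "(u, F) \<in> operators"
    by (cases x) (auto simp: operator_algebra_def)
  have "rb_op operator_algebra (c \<odot>\<^bsub>operator_algebra\<^esub> x) = corner (rb_op A (c \<odot>\<^bsub>A\<^esub> u 0))"
    by (simp add: operator_algebra_def x)
  also have "\<dots> = c \<odot>\<^bsub>operator_algebra\<^esub> corner (rb_op A (u 0))"
    using operatorsD(1)[OF x(2)] c by (simp add: rb_op_smult rb_op_closed seqsD corner_smult)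
  finally show "rb_op operator_algebra (c \<odot>\<^bsub>operator_algebra\<^esub> x)
      = c \<odot>\<^bsub>operator_algebra\<^esub> rb_op operator_algebra x"
    by (simp add: operator_algebra_def x)
qed (auto simp: operator_algebra_def operators_mult compose_eq operatorsD seqsD
       add_seqs smult_seqs corner_operators rb_op_closed
     intro!: extensionalityI[where A = seqs])

section \<open>The two generators\<close>

text \<open>With x = \<open>shift 0\<close>, this is the power x^(m+1): without a unit, exponents
  start at 1.\<close>

definition shift where
  "shift m = ((\<lambda>_. \<zero>\<^bsub>A\<^esub>), \<lambda>w\<in>seqs. \<lambda>n. w (n + Suc m))"

text \<open>The generator y for a general \<open>\<alpha>\<close>. Entry 0 becomes a right factor of
  \<open>\<alpha>\<close> and entry 1 moves to position 0; \<open>e\<close> acts like a sequence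
  with a unit at position 0 only, hence the value \<open>\<alpha>\<close>.\<close>

definition spread where
  "spread \<alpha> = (\<alpha>, \<lambda>w\<in>seqs. \<lambda>n. \<alpha> n \<otimes>\<^bsub>A\<^esub> w 0 \<oplus>\<^bsub>A\<^esub> single (w 1) n)"

lemma single_closed: "a \<in> carrier A \<Longrightarrow> single a n \<in> carrier A"
  by (simp add: single_def)

lemma single_Suc: "single a (Suc n) = \<zero>\<^bsub>A\<^esub>"
  and single_zero: "single \<zero>\<^bsub>A\<^esub> n = \<zero>\<^bsub>A\<^esub>"
  by (simp_all add: single_def)

lemma single_mult:
  "b \<in> carrier A \<Longrightarrow> single (a \<otimes>\<^bsub>A\<^esub> b) = (\<lambda>n. single a n \<otimes>\<^bsub>A\<^esub> b)"
  by (auto simp: single_def zero_mult)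

lemma shift_operators: "shift m \<in> operators"
  unfolding shift_def
  by (intro operatorsI)
    (simp_all add: seqsI seqsD single_seqs add_seqs smult_seqs mult_seqs zero_mult single_Suc)

lemma spread_operators:
  assumes "\<alpha> \<in> seqs"
  shows "spread \<alpha> \<in> operators"
proof -
  have "\<alpha> n \<in> carrier A" for n using assms by (rule seqsD)
  then show ?thesis
    unfolding spread_def
    by (intro operatorsI)
      (simp_all add: assms seqsI seqsD single_seqs add_seqs smult_seqs mult_seqs mult_closed
        single_closed single_0 single_Suc single_zero single_add single_smult single_mult
        distrib_left distrib_right smult_r_distr smult_mult_right mult_assoc M.a_ac)
qed

lemma shift_Suc: "shift (Suc m) = shift 0 \<otimes>\<^bsub>operator_algebra\<^esub> shift m"
  unfolding shift_def operator_algebra_def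
  by (auto simp: compose_def seqsI seqsD intro!: restrict_ext)

text \<open>On a sequence \<open>w\<close>, the shift discards position 0 and with it the summand
  \<open>single (w 1)\<close>, leaving the tail of \<open>\<alpha>\<close> from \<open>Suc m\<close>
  on, times \<open>w 0\<close>. Its first entry vanishes by \<open>zero\<close>, so the outer
  \<open>spread\<close> only moves the next entry to position 0.\<close>

lemma spread_shift_spread:
  assumes \<alpha>: "\<alpha> \<in> seqs" and zero: "\<alpha> (Suc m) = \<zero>\<^bsub>A\<^esub>"
  shows "spread \<alpha> \<otimes>\<^bsub>operator_algebra\<^esub> (shift m \<otimes>\<^bsub>operator_algebra\<^esub> spread \<alpha>)
    = corner (\<alpha> (Suc (Suc m)))"
proof -
  \<comment> \<open>Restricted maps evaluate only on members of \<open>seqs\<close>; the three facts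
    treat the shifted \<open>\<alpha>\<close>, the spread of \<open>w\<close>, and the shift of
    that.\<close>
  have 1: "(\<lambda>n. \<alpha> (Suc (n + m))) \<in> seqs" using \<alpha> by (auto intro: seqsI seqsD)
  have 2: "(\<lambda>n. \<alpha> n \<otimes>\<^bsub>A\<^esub> w 0 \<oplus>\<^bsub>A\<^esub> single (w (Suc 0)) n) \<in> seqs" if "w \<in> seqs" for w
    using \<alpha> that by (intro seqsI) (simp add: seqsD mult_closed single_closed)
  have 3: "(\<lambda>n. \<alpha> (Suc (n + m)) \<otimes>\<^bsub>A\<^esub> w 0 \<oplus>\<^bsub>A\<^esub> single (w (Suc 0)) (Suc (n + m))) \<in> seqs" if "w \<in> seqs" for w
    using \<alpha> that by (intro seqsI) (simp add: seqsD mult_closed single_closed)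
  show ?thesis
    unfolding shift_def spread_def operator_algebra_def corner_def
    using \<alpha> zero 1 2 3 seqsD[OF \<alpha>]
    by (simp add: compose_def seqsD mult_closed single_closed zero_mult single_Suc single_0
        mult_zero cong: restrict_cong)
qed

lemma two_generated_extension:
  assumes "countably_generated K A"
  shows "\<exists>x y. x \<in> carrier operator_algebra \<and> y \<in> carrier operator_algebra
    \<and> corner ` carrier A \<subseteq> rb_generate K operator_algebra {x, y}"
proof -
  obtain S where S: "countable S" "S \<subseteq> carrier A" "rb_generate K A S = carrier A"
    using assms by (auto simp: countably_generated_def)
  define a where "a = from_nat_into (insert \<zero>\<^bsub>A\<^esub> S)"
  have a: "range a = insert \<zero>\<^bsub>A\<^esub> S"
    unfolding a_def using S(1) by (intro range_from_nat_into) auto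
  \<comment> \<open>\<open>a n\<close> sits at position 2n + 2, preceded by a zero at 2n + 1, as
    required for \<open>m = 2 * n\<close>. Position 0 is zero because only positions from 2 on can
    be extracted.\<close>
  define \<alpha> where "\<alpha> = (\<lambda>n. if n \<ge> 2 \<and> even n then a (n div 2 - 1) else \<zero>\<^bsub>A\<^esub>)"
  have "a n \<in> carrier A" for n
    using a S(2) rangeI[of a n] by auto
  then have \<alpha>: "\<alpha> \<in> seqs" by (intro seqsI) (simp add: \<alpha>_def)
  let ?G = "rb_generate K operator_algebra {shift 0, spread \<alpha>}"
  have shift: "shift m \<in> ?G" for m
    by (induction m) (auto simp: shift_Suc intro: rb_generate.intros)
  have a_mem: "corner (a n) \<in> ?G" for n
  proof -
    have "spread \<alpha> \<otimes>\<^bsub>operator_algebra\<^esub> (shift (2 * n) \<otimes>\<^bsub>operator_algebra\<^esub> spread \<alpha>) \<in> ?G"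
      using shift by (intro rb_generate.mult) (auto intro: rb_generate.gen)
    then show ?thesis using spread_shift_spread[OF \<alpha>, of "2 * n"] by (simp add: \<alpha>_def)
  qed
  have "corner ` S \<subseteq> ?G"
  proof
    fix z assume "z \<in> corner ` S"
    then obtain s where s: "s \<in> range a" "z = corner s" unfolding a by blast
    then obtain n where "s = a n" by blast
    then show "z \<in> ?G" using a_mem s(2) by simp
  qed
  \<comment> \<open>As \<open>corner\<close> is a homomorphism, capturing the images of the
    generators captures all of \<open>A\<close>.\<close>
  then have "corner ` carrier A \<subseteq> ?G"
    using rb_hom_generate[OF rota_baxter_algebra_axioms rota_baxter_operator_algebra corner_hom S(2)]
    by (simp add: S(3))
  moreover have "shift 0 \<in> carrier operator_algebra" "spread \<alpha> \<in> carrier operator_algebra"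
    using shift_operators spread_operators[OF \<alpha>] by (auto simp: operator_algebra_def)
  ultimately show ?thesis by blast
qed

end

section \<open>The embedding\<close>

theorem theorem4p3:
  fixes A :: "('k::field_char_0, 'a) rb_algebra"
  assumes "rota_baxter_algebra ring_of_type_algebra A"
    and "countably_generated ring_of_type_algebra A"
  shows "\<exists>(B :: ('k, nat \<Rightarrow> 'k) rb_algebra) f.
           rota_baxter_algebra ring_of_type_algebra B \<and>
           two_generated ring_of_type_algebra B \<and>
           f \<in> rb_hom ring_of_type_algebra A B \<and> inj_on f (carrier A)"
proof -
  let ?K = "ring_of_type_algebra :: 'k ring"
  interpret A: rota_baxter_algebra ?K A by fact
  interpret M: rota_baxter_algebra ?K A.operator_algebra
    by (rule A.rota_baxter_operator_algebra)
  obtain x y where xy: "x \<in> carrier A.operator_algebra" "y \<in> carrier A.operator_algebra"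
    and corner: "A.corner ` carrier A \<subseteq> rb_generate ?K A.operator_algebra {x, y}"
    using A.two_generated_extension[OF assms(2)] by blast
  \<comment> \<open>The subalgebra generated by \<open>x\<close> and \<open>y\<close> still contains
    the image of \<open>A\<close>, and it has two generators by construction.\<close>
  define C where
    "C = A.operator_algebra\<lparr>carrier := rb_generate ?K A.operator_algebra {x, y}\<rparr>"
  interpret C: rota_baxter_algebra ?K C
    unfolding C_def using xy by (intro M.rota_baxter_generate) auto
  have carrier_C: "carrier C = rb_generate ?K C {x, y}"
    by (simp add: C_def rb_generate_carrier_update)
  \<comment> \<open>The generating set is finite, so \<open>C\<close> injects into sequences of
    scalars whatever the type of \<open>A\<close>.\<close>
  obtain L :: "_ \<Rightarrow> nat \<Rightarrow> 'k" where L: "inj_on L (carrier C)"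
    using rb_generate_injection[of "{x, y}" ?K C] carrier_C by auto
  let ?B = "transport L C"
  note B = C.rota_baxter_transport[OF L] and L_hom = C.transport_hom[OF L]
  have gens: "{x, y} \<subseteq> carrier C" unfolding carrier_C by (auto intro: rb_generate.gen)
  then have gens_B: "L ` {x, y} \<subseteq> carrier ?B" by (auto simp: transport_def Let_def)
  \<comment> \<open>\<open>L\<close> is a homomorphism onto \<open>?B\<close>, so the images of
    \<open>x\<close> and \<open>y\<close> generate \<open>?B\<close>.\<close>
  have "L ` rb_generate ?K C {x, y} \<subseteq> rb_generate ?K ?B (L ` {x, y})"
    by (rule rb_hom_generate[OF C.rota_baxter_algebra_axioms B L_hom gens])
      (auto intro: rb_generate.gen)
  then have "carrier ?B \<subseteq> rb_generate ?K ?B {L x, L y}"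
    by (simp add: carrier_C[symmetric]) (simp add: transport_def Let_def)
  moreover have "rb_generate ?K ?B {L x, L y} \<subseteq> carrier ?B"
    using rota_baxter_algebra.generate_closed[OF B gens_B] by simp
  ultimately have "two_generated ?K ?B"
    using gens_B by (auto simp: two_generated_def)
  \<comment> \<open>\<open>C\<close> inherits its operations from the operator algebra, so
    \<open>corner\<close> is also a homomorphism into \<open>C\<close>.\<close>
  moreover have "L \<circ> A.corner \<in> rb_hom ?K A ?B"
    using A.corner_hom L_hom corner by (auto simp: rb_hom_def C_def image_subset_iff)
  moreover have "inj_on (L \<circ> A.corner) (carrier A)"
    using A.inj_corner L corner by (auto simp: C_def intro: comp_inj_on inj_on_subset)
  ultimately show ?thesis using B by blast
qed

end
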